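(* The minimal elements in the partially ordered set $\mathcal{A}$ are exactly those that belong to the set $\mathcal{A}_0$.
   Context: $\mathbb{Z}^+=\{1,2,3,\dots\}$. An admissible function of angles is a pair $(E,\eta)$ with $E\subset(0,\pi)$ a set and $\eta:E\to\mathbb{Z}^+$ a function such that for every $k\in\mathbb{Z}^+$ there exists $\theta\in E$ with $\sin(k\theta)\neq0$ and $k\geq\eta(\theta)$. $\mathcal{A}$ denotes the set of all admissible functions of angles, partially ordered by: $(E_1,\eta_1)\leq(E_2,\eta_2)$ if $E_1\subset E_2$ and $\eta_1(\theta)\geq\eta_2(\theta)$ for all $\theta\in E_1$. An element $m$ of a partially ordered set $\mathcal{M}$ is minimal if $x\in\mathcal{M}$ and $x\leq m$ imply $x=m$. For $\theta\in\mathbb{R}$ the set $\mathcal{I}(\theta)=\{m\in\mathbb{Z}:\sin(m\theta)=0\}$ is an ideal in $\mathbb{Z}$, and $d(\theta)\geq0$ denotes its unique non-negative generator: $\mathcal{I}(\theta)=d(\theta)\mathbb{Z}$. $\operatorname{lcm}$ denotes the (non-negative) least common multiple. $\mathcal{A}_0\subset\mathcal{A}$ is the subset of those $(E,\eta)$ that arise from one of the following two constructions (both of which yield admissible functions of angles): (i) Infinite case: $\{\theta_k\}_{k=1}^\infty$ is an infinite sequence of rational multiples of $\pi$ in $(0,\pi)$ with $d(\theta_k)\nmid\operatorname{lcm}(d(\theta_1),\dots,d(\theta_{k-1}))$ for all $k\geq2$; $E=\{\theta_k:k\geq1\}$, $\eta(\theta_1)=1$ and $\eta(\theta_k)=\operatorname{lcm}(d(\theta_1),\dots,d(\theta_{k-1}))$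 for $k\geq2$. (ii) Finite case: $n\in\{0,1,2,\dots\}$, $\{\theta_k\}_{k=1}^n$ is a finite (possibly empty) sequence of rational multiples of $\pi$ in $(0,\pi)$ with $d(\theta_k)\nmid\operatorname{lcm}(d(\theta_1),\dots,d(\theta_{k-1}))$ for $2\leq k\leq n$, and $\theta_{n+1}\in(0,\pi)$ is an irrational multiple of $\pi$; $E=\{\theta_k:1\leq k\leq n+1\}$, $\eta(\theta_1)=1$ and $\eta(\theta_k)=\operatorname{lcm}(d(\theta_1),\dots,d(\theta_{k-1}))$ for $2\leq k\leq n+1$. *)

theory Defs
  imports Complex_Main "HOL-Library.FuncSet"
begin

type_synonym angle_fun = "real set \<times> (real \<Rightarrow> nat)"

text \<open>
  The partial map \<open>\<eta>\<close> on \<open>E\<close> is encoded by an extensional total function (\<open>undefined\<close> outside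
  \<open>E\<close>), so that equality of pairs is equality of the mathematical objects.
\<close>

definition admissible :: "angle_fun set" where
  "admissible = {(E, \<eta>). E \<subseteq> {0<..<pi} \<and> \<eta> \<in> E \<rightarrow>\<^sub>E {1..} \<and>
     (\<forall>k\<ge>1. \<exists>\<theta>\<in>E. sin (real k * \<theta>) \<noteq> 0 \<and> k \<ge> \<eta> \<theta>)}"

definition angle_le :: "angle_fun \<Rightarrow> angle_fun \<Rightarrow> bool"  (infix \<open>\<sqsubseteq>\<close> 50) where
  "p \<sqsubseteq> q \<longleftrightarrow> fst p \<subseteq> fst q \<and> (\<forall>\<theta>\<in>fst p. snd p \<theta> \<ge> snd q \<theta>)"

lemma partial_order_on_admissible:
  "partial_order_on admissible {(p, q). p \<in> admissible \<and> q \<in> admissible \<and> p \<sqsubseteq> q}"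
proof -
  have "p = q" if "p \<in> admissible" "q \<in> admissible" "p \<sqsubseteq> q" "q \<sqsubseteq> p" for p q
  proof (rule prod_eqI)
    show E: "fst p = fst q" using that by (auto simp: angle_le_def)
    show "snd p = snd q"
    proof
      fix \<theta>
      show "snd p \<theta> = snd q \<theta>"
      proof (cases "\<theta> \<in> fst p")
        case True
        then show ?thesis using that E by (intro antisym) (auto simp: angle_le_def)
      next
        case False
        then show ?thesis using that E by (auto simp: admissible_def PiE_def extensional_def)
      qed
    qed
  qed
  moreover have "p \<sqsubseteq> r" if "p \<sqsubseteq> q" "q \<sqsubseteq> r" for p q r
    using that unfolding angle_le_def by (meson order_trans subsetD)
  ultimately show ?thesis
    unfolding partial_order_on_def preorder_on_def refl_on_def antisym_def trans_def
    by (auto 0 3 simp: angle_le_def[of p p for p])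
qed

definition minimal_in :: "('a \<Rightarrow> 'a \<Rightarrow> bool) \<Rightarrow> 'a set \<Rightarrow> 'a \<Rightarrow> bool" where
  "minimal_in le M m \<longleftrightarrow> m \<in> M \<and> (\<forall>x\<in>M. le x m \<longrightarrow> x = m)"

definition sin_ideal :: "real \<Rightarrow> int set" where
  "sin_ideal \<theta> = {m. sin (real_of_int m * \<theta>) = 0}"

definition ideal_gen :: "real \<Rightarrow> nat" where
  "ideal_gen \<theta> = (THE d. sin_ideal \<theta> = range (\<lambda>z. int d * z))"

lemma ex1_ideal_gen: "\<exists>!d::nat. sin_ideal \<theta> = range (\<lambda>z. int d * z)"
proof -
  let ?I = "sin_ideal \<theta>"
  have add: "a + b \<in> ?I" if "a \<in> ?I" "b \<in> ?I" for a b
    using that by (auto simp: sin_ideal_def ring_distribs sin_add)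
  have mult: "a * b \<in> ?I" if a: "a \<in> ?I" for a b
  proof -
    obtain i :: int where "real_of_int a * \<theta> = of_int i * pi"
      using a by (auto simp: sin_ideal_def sin_zero_iff_int2)
    then have "real_of_int (a * b) * \<theta> = of_int (b * i) * pi"
      by (simp add: mult_ac)
    then show ?thesis unfolding sin_ideal_def sin_zero_iff_int2 by blast
  qed
  define d where "d = (if \<exists>n>0. int n \<in> ?I then LEAST n. n > 0 \<and> int n \<in> ?I else 0)"
  have d_in: "int d \<in> ?I"
  proof (cases "\<exists>n>0. int n \<in> ?I")
    case True
    then show ?thesis using LeastI_ex[OF True] by (simp add: d_def)
  next
    case False
    then have "d = 0" by (simp only: d_def if_False)
    then show ?thesis by (simp add: sin_ideal_def)
  qed
  have d_dvd: "int d dvd m" if m: "m \<in> ?I" for m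
  proof (cases "d = 0")
    case True
    have "m = 0"
    proof (rule ccontr)
      assume "m \<noteq> 0"
      moreover have "\<bar>m\<bar> \<in> ?I" using mult[OF m, of "sgn m"] by (simp add: abs_sgn)
      ultimately have ex: "\<exists>n>0. int n \<in> ?I" by (intro exI[of _ "nat \<bar>m\<bar>"]) auto
      then have "d > 0" unfolding d_def using LeastI_ex[OF ex] by auto
      then show False using True by simp
    qed
    then show ?thesis by simp
  next
    case False
    then have ex: "\<exists>n>0. int n \<in> ?I" by (auto simp: d_def split: if_splits)
    have "m mod int d = m + int d * (- (m div int d))"
      by (simp add: minus_div_mult_eq_mod[symmetric] mult.commute)
    then have "m mod int d \<in> ?I" using add[OF m mult[OF d_in]] by metis
    then have r: "int (nat (m mod int d)) \<in> ?I" using False by simp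
    have "nat (m mod int d) < d" using False by (simp add: nat_less_iff)
    moreover have "d = (LEAST n. n > 0 \<and> int n \<in> ?I)" using ex by (simp add: d_def)
    ultimately have "\<not> nat (m mod int d) > 0"
      using r not_less_Least by metis
    moreover have "m mod int d \<ge> 0" using False by simp
    ultimately have "m mod int d = 0" by linarith
    then show ?thesis by auto
  qed
  have "?I = range (\<lambda>z. int d * z)"
    using d_dvd mult[OF d_in] by (auto elim!: dvdE)
  moreover have "a = b" if "range (\<lambda>z. int a * z) = range (\<lambda>z. int b * z)" for a b :: nat
  proof (rule dvd_antisym)
    have "int a \<in> range (\<lambda>z. int b * z)" using that by (metis mult.right_neutral rangeI)
    then show "b dvd a" by (metis dvd_triv_left image_iff int_dvd_int_iff)
    have "int b \<in> range (\<lambda>z. int a * z)" using that by (metis mult.right_neutral rangeI)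
    then show "a dvd b" by (metis dvd_triv_left image_iff int_dvd_int_iff)
  qed
  ultimately show ?thesis by metis
qed

lemma sin_ideal_eq: "sin_ideal \<theta> = range (\<lambda>z. int (ideal_gen \<theta>) * z)"
  unfolding ideal_gen_def by (rule theI'[OF ex1_ideal_gen])

definition rational_angle :: "real \<Rightarrow> bool" where
  "rational_angle \<theta> \<longleftrightarrow> (\<exists>q\<in>\<rat>. \<theta> = q * pi)"

text \<open>
  Sequences of angles are indexed from 1; for a finite sequence only the values at the indices
  in its range are constrained.
\<close>

definition lcm_before :: "(nat \<Rightarrow> real) \<Rightarrow> nat \<Rightarrow> nat" where
  "lcm_before \<theta> k = Lcm ((\<lambda>j. ideal_gen (\<theta> j)) ` {1..<k})"

definition infinite_construction :: "angle_fun set" where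
  "infinite_construction = {(E, \<eta>). \<exists>\<theta> :: nat \<Rightarrow> real.
     (\<forall>k\<ge>1. \<theta> k \<in> {0<..<pi} \<and> rational_angle (\<theta> k)) \<and>
     (\<forall>k\<ge>2. \<not> ideal_gen (\<theta> k) dvd lcm_before \<theta> k) \<and>
     E = \<theta> ` {1..} \<and> \<eta> \<in> extensional E \<and>
     \<eta> (\<theta> 1) = 1 \<and> (\<forall>k\<ge>2. \<eta> (\<theta> k) = lcm_before \<theta> k)}"

definition finite_construction :: "angle_fun set" where
  "finite_construction = {(E, \<eta>). \<exists>(n :: nat) (\<theta> :: nat \<Rightarrow> real).
     (\<forall>k\<in>{1..n}. \<theta> k \<in> {0<..<pi} \<and> rational_angle (\<theta> k)) \<and>
     (\<forall>k\<in>{2..n}. \<not> ideal_gen (\<theta> k) dvd lcm_before \<theta> k) \<and>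
     \<theta> (n + 1) \<in> {0<..<pi} \<and> \<not> rational_angle (\<theta> (n + 1)) \<and>
     E = \<theta> ` {1..n + 1} \<and> \<eta> \<in> extensional E \<and>
     \<eta> (\<theta> 1) = 1 \<and> (\<forall>k\<in>{2..n + 1}. \<eta> (\<theta> k) = lcm_before \<theta> k)}"

definition admissible0 :: "angle_fun set" where
  "admissible0 = infinite_construction \<union> finite_construction"

end

theory Submission
  imports Defs
begin

text \<open>
  Since \<open>sin (k * \<theta>) \<noteq> 0\<close> means that \<open>d(\<theta>)\<close> does not divide \<open>k\<close>, a sequence whose every
  \<open>d(\<theta>\<^sub>k)\<close> fails to divide the lcm \<open>L\<^sub>k\<close> of its predecessors can only satisfy the
  admissibility condition at \<open>L\<^sub>k\<close> through \<open>\<theta>\<^sub>k\<close> itself: the earlier angles have their \<open>d\<close>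
  dividing \<open>L\<^sub>k\<close>, and the later ones have \<open>\<eta> > L\<^sub>k\<close>. This gives minimality. Conversely, choosing
  greedily inside any admissible pair an angle that witnesses admissibility at the current lcm
  yields an element of \<open>admissible0\<close> below the given pair.
\<close>

section \<open>Vanishing of sines as divisibility by \<open>ideal_gen\<close>\<close>

lemma sin_mult_eq_0_iff: "sin (real k * \<theta>) = 0 \<longleftrightarrow> ideal_gen \<theta> dvd k"
proof -
  have "sin (real k * \<theta>) = 0 \<longleftrightarrow> int k \<in> sin_ideal \<theta>"
    by (simp add: sin_ideal_def)
  also have "\<dots> \<longleftrightarrow> int (ideal_gen \<theta>) dvd int k"
    by (subst sin_ideal_eq) (auto simp: dvd_def)
  finally show ?thesis by simp
qed

text \<open>Sine is positive on (0, pi). This supplies the non-divisibility at index 1, which both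
  constructions state only from index 2 on.\<close>

lemma ideal_gen_not_dvd_1:
  assumes "\<theta> \<in> {0<..<pi}"
  shows "\<not> ideal_gen \<theta> dvd 1"
  using sin_mult_eq_0_iff[of 1 \<theta>] sin_gt_zero[of \<theta>] assms by auto

text \<open>A nonzero multiple of the angle is an integer multiple of pi exactly when the angle is
  rational. Since 0 divides no positive number, an irrational angle has nonzero sine at every
  positive multiple.\<close>

lemma ideal_gen_eq_0_iff: "ideal_gen \<theta> = 0 \<longleftrightarrow> \<not> rational_angle \<theta>"
proof
  assume d: "ideal_gen \<theta> = 0"
  show "\<not> rational_angle \<theta>"
  proof
    assume "rational_angle \<theta>"
    then obtain q where "q \<in> \<rat>" and q: "\<theta> = q * pi" by (auto simp: rational_angle_def)
    then obtain m n where "n > 0" and "q = of_int m / of_int n"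
      by (auto elim: Rats_cases')
    then have "real (nat n) * \<theta> = of_int m * pi" using q by simp
    then have "ideal_gen \<theta> dvd nat n"
      unfolding sin_mult_eq_0_iff[symmetric] sin_zero_iff_int2 by blast
    then show False using d \<open>n > 0\<close> by simp
  qed
next
  assume irr: "\<not> rational_angle \<theta>"
  show "ideal_gen \<theta> = 0"
  proof (rule ccontr)
    assume d: "ideal_gen \<theta> \<noteq> 0"
    have "sin (real (ideal_gen \<theta>) * \<theta>) = 0" by (simp add: sin_mult_eq_0_iff)
    then obtain i :: int where "real (ideal_gen \<theta>) * \<theta> = of_int i * pi"
      by (auto simp: sin_zero_iff_int2)
    then have "\<theta> = (of_int i / of_nat (ideal_gen \<theta>)) * pi"
      using d by (simp add: field_simps)
    then show False using irr unfolding rational_angle_def by (metis Rats_divide Rats_of_int Rats_of_nat)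
  qed
qed

section \<open>Running least common multiples\<close>

lemma lcm_before_1 [simp]: "lcm_before \<theta> (Suc 0) = 1"
  by (simp add: lcm_before_def)

lemma lcm_before_Suc:
  assumes "k \<ge> 1"
  shows "lcm_before \<theta> (Suc k) = lcm (ideal_gen (\<theta> k)) (lcm_before \<theta> k)"
  using assms by (simp add: lcm_before_def atLeastLessThanSuc)

lemma ideal_gen_dvd_lcm_before:
  assumes "1 \<le> j" "j < k"
  shows "ideal_gen (\<theta> j) dvd lcm_before \<theta> k"
  using assms by (auto simp: lcm_before_def intro!: dvd_Lcm)

lemma lcm_before_dvd_mono:
  assumes "j \<le> k"
  shows "lcm_before \<theta> j dvd lcm_before \<theta> k"
  unfolding lcm_before_def using assms by (intro Lcm_subset image_mono) auto

text \<open>A finite lcm is zero only if some entry is zero, and only irrational angles contribute a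
  zero.\<close>

lemma lcm_before_pos:
  assumes "\<And>j. \<lbrakk>1 \<le> j; j < k\<rbrakk> \<Longrightarrow> rational_angle (\<theta> j)"
  shows "lcm_before \<theta> k > 0"
proof -
  have "0 \<notin> (\<lambda>j. ideal_gen (\<theta> j)) ` {1..<k}"
    using assms by (metis (no_types, lifting) atLeastLessThan_iff ideal_gen_eq_0_iff imageE)
  then show ?thesis
    by (simp add: lcm_before_def Lcm_0_iff flip: neq0_conv)
qed

text \<open>
  The common shape of both constructions: the index set \<open>I\<close> is \<open>{1..}\<close> or \<open>{1..n + 1}\<close>.
\<close>
locale angle_sequence =
  fixes I :: "nat set" and \<theta> :: "nat \<Rightarrow> real"
  assumes index_ge_1: "k \<in> I \<Longrightarrow> k \<ge> 1"
    and index_down: "k \<in> I \<Longrightarrow> 1 \<le> j \<Longrightarrow> j \<le> k \<Longrightarrow> j \<in> I"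
    and angle_range: "k \<in> I \<Longrightarrow> \<theta> k \<in> {0<..<pi}"
    and not_dvd: "k \<in> I \<Longrightarrow> \<not> ideal_gen (\<theta> k) dvd lcm_before \<theta> k"
    and ex_not_dvd: "k \<ge> 1 \<Longrightarrow> \<exists>j\<in>I. \<not> ideal_gen (\<theta> j) dvd k"
begin

text \<open>Everything divides 0, so \<open>not_dvd\<close> already excludes the value 0.\<close>

lemma lcm_before_ge_1: "k \<in> I \<Longrightarrow> lcm_before \<theta> k \<ge> 1"
  using not_dvd[of k] by (cases "lcm_before \<theta> k") auto

text \<open>The generator of \<open>\<theta> j\<close> divides the later value but not the earlier
  one, so the divisibility between the two is proper.\<close>

lemma lcm_before_strict_mono:
  assumes "j \<in> I" "k \<in> I" "j < k"
  shows "lcm_before \<theta> j < lcm_before \<theta> k"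
proof -
  have "lcm_before \<theta> j \<noteq> lcm_before \<theta> k"
    using not_dvd[of j] ideal_gen_dvd_lcm_before[of j k \<theta>] index_ge_1 assms by metis
  moreover have "lcm_before \<theta> j \<le> lcm_before \<theta> k"
    using lcm_before_dvd_mono[of j k \<theta>] lcm_before_ge_1[of k] assms by (intro dvd_imp_le) auto
  ultimately show ?thesis by simp
qed

lemma inj_on_angle: "inj_on \<theta> I"
  using not_dvd ideal_gen_dvd_lcm_before index_ge_1 by (metis (no_types) linorder_inj_onI')

context
  fixes \<eta> :: "real \<Rightarrow> nat"
  assumes ext: "\<eta> \<in> extensional (\<theta> ` I)"
    and \<eta>_eq: "k \<in> I \<Longrightarrow> \<eta> (\<theta> k) = lcm_before \<theta> k"
begin

lemma admissible: "(\<theta> ` I, \<eta>) \<in> admissible"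
proof -
  have "\<exists>\<phi>\<in>\<theta> ` I. sin (real k * \<phi>) \<noteq> 0 \<and> k \<ge> \<eta> \<phi>" if k: "k \<ge> 1" for k
  proof -
    \<comment> \<open>Taking the first index whose generator does not divide \<open>k\<close> makes
      all earlier generators divide \<open>k\<close>. Hence their lcm, the value of \<eta> there,
      divides \<open>k\<close> and is at most \<open>k\<close>.\<close>
    define j where "j = (LEAST j. j \<in> I \<and> \<not> ideal_gen (\<theta> j) dvd k)"
    have j: "j \<in> I" "\<not> ideal_gen (\<theta> j) dvd k"
      using LeastI_ex[of "\<lambda>j. j \<in> I \<and> \<not> ideal_gen (\<theta> j) dvd k"] ex_not_dvd[OF k]
      unfolding j_def by auto
    have "ideal_gen (\<theta> i) dvd k" if "1 \<le> i" "i < j" for i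
      using not_less_Least[of i "\<lambda>j. j \<in> I \<and> \<not> ideal_gen (\<theta> j) dvd k"] that
        index_down[OF j(1), of i] unfolding j_def[symmetric] by auto
    then have "lcm_before \<theta> j dvd k" by (auto simp: lcm_before_def intro!: Lcm_least)
    then have "\<eta> (\<theta> j) \<le> k" using \<eta>_eq[OF j(1)] k by (auto dest: dvd_imp_le)
    then show ?thesis using j by (auto simp: sin_mult_eq_0_iff)
  qed
  moreover have "\<eta> \<in> \<theta> ` I \<rightarrow>\<^sub>E {1..}"
    using ext lcm_before_ge_1 \<eta>_eq by (auto simp: PiE_def Pi_def)
  ultimately show ?thesis using angle_range by (auto simp: admissible_def)
qed

lemma minimal: "minimal_in (\<sqsubseteq>) admissible (\<theta> ` I, \<eta>)"
  unfolding minimal_in_def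
proof (intro conjI ballI impI)
  show "(\<theta> ` I, \<eta>) \<in> admissible" by (rule admissible)
next
  fix x assume x: "x \<in> admissible" and le: "x \<sqsubseteq> (\<theta> ` I, \<eta>)"
  obtain E' \<eta>' where x_eq: "x = (E', \<eta>')" by fastforce
  have sub: "E' \<subseteq> \<theta> ` I" and ge: "\<And>\<phi>. \<phi> \<in> E' \<Longrightarrow> \<eta>' \<phi> \<ge> \<eta> \<phi>"
    using le by (auto simp: x_eq angle_le_def)
  have key: "\<theta> j \<in> E' \<and> \<eta>' (\<theta> j) = \<eta> (\<theta> j)" if j: "j \<in> I" for j
  proof -
    obtain \<phi> where \<phi>: "\<phi> \<in> E'" "sin (real (lcm_before \<theta> j) * \<phi>) \<noteq> 0" "lcm_before \<theta> j \<ge> \<eta>' \<phi>"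
      using x lcm_before_ge_1[OF j] unfolding x_eq admissible_def by blast
    obtain i where i: "i \<in> I" "\<phi> = \<theta> i" using \<phi>(1) sub by auto
    have "\<not> i < j"
      using \<phi>(2) ideal_gen_dvd_lcm_before[of i j \<theta>] index_ge_1[OF i(1)]
      by (auto simp: sin_mult_eq_0_iff i)
    moreover have "\<not> j < i"
      using lcm_before_strict_mono[OF j i(1)] \<phi>(3) ge[OF \<phi>(1)] \<eta>_eq[OF i(1)] i(2) by auto
    ultimately have "i = j" by simp
    \<comment> \<open>The witness gives \<eta>' \<le> \<eta> at \<open>\<theta> j\<close>, and lying
      below gives the reverse inequality.\<close>
    then show ?thesis using \<phi> i ge[OF \<phi>(1)] \<eta>_eq[OF j] by auto
  qed
  have E: "E' = \<theta> ` I" using key sub by auto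
  have "\<eta>' = \<eta>"
  proof (rule extensionalityI)
    show "\<eta>' \<in> extensional (\<theta> ` I)" using x by (auto simp: x_eq admissible_def PiE_def E)
  qed (use ext key in auto)
  then show "x = (\<theta> ` I, \<eta>)" by (simp add: x_eq E)
qed

end

end

section \<open>The two constructions as angle sequences, and their minimality\<close>

lemma angle_sequence_infinite:
  assumes "\<And>k. k \<ge> 1 \<Longrightarrow> \<theta> k \<in> {0<..<pi} \<and> rational_angle (\<theta> k)"
    and nd: "\<And>k. k \<ge> 2 \<Longrightarrow> \<not> ideal_gen (\<theta> k) dvd lcm_before \<theta> k"
  shows "angle_sequence {1..} \<theta>"
proof -
  have nd': "\<not> ideal_gen (\<theta> k) dvd lcm_before \<theta> k" if "k \<ge> 1" for k
    using nd[of k] ideal_gen_not_dvd_1[of "\<theta> 1"] assms(1)[of 1] that by (cases "k = 1") auto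
  have pos: "lcm_before \<theta> k > 0" for k
    using assms(1) by (intro lcm_before_pos) auto
  have step: "lcm_before \<theta> (Suc k) < lcm_before \<theta> (Suc (Suc k))" for k
  proof -
    have "lcm_before \<theta> (Suc k) \<noteq> lcm_before \<theta> (Suc (Suc k))"
      using nd'[of "Suc k"] ideal_gen_dvd_lcm_before[of "Suc k" "Suc (Suc k)" \<theta>] by auto
    moreover have "lcm_before \<theta> (Suc k) \<le> lcm_before \<theta> (Suc (Suc k))"
      by (intro dvd_imp_le[OF lcm_before_dvd_mono pos]) simp
    ultimately show ?thesis by simp
  qed
  \<comment> \<open>Strict growth makes the lcms unbounded, so no positive \<open>k\<close> can be a
    common multiple of all generators.\<close>
  have large: "k < lcm_before \<theta> (Suc k)" for k
  proof (induction k)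
    case (Suc k)
    then show ?case using step[of k] by linarith
  qed simp
  have "\<exists>j\<in>{1..}. \<not> ideal_gen (\<theta> j) dvd k" if k: "k \<ge> 1" for k
  proof (rule ccontr)
    assume "\<not> ?thesis"
    then have "lcm_before \<theta> (Suc k) dvd k"
      by (auto simp: lcm_before_def intro!: Lcm_least)
    then have "lcm_before \<theta> (Suc k) \<le> k" using k by (intro dvd_imp_le) auto
    then show False using large[of k] by simp
  qed
  then show ?thesis using assms(1) nd' by unfold_locales auto
qed

lemma angle_sequence_finite:
  assumes "\<And>k. k \<in> {1..n} \<Longrightarrow> \<theta> k \<in> {0<..<pi} \<and> rational_angle (\<theta> k)"
    and nd: "\<And>k. k \<in> {2..n} \<Longrightarrow> \<not> ideal_gen (\<theta> k) dvd lcm_before \<theta> k"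
    and last: "\<theta> (n + 1) \<in> {0<..<pi}" "\<not> rational_angle (\<theta> (n + 1))"
  shows "angle_sequence {1..n + 1} \<theta>"
proof -
  \<comment> \<open>The generator 0 of the last angle serves twice: it does not divide the positive
    lcm before it, and it does not divide any \<open>k\<close> \<ge> 1.\<close>
  have d0: "ideal_gen (\<theta> (n + 1)) = 0" using last by (simp add: ideal_gen_eq_0_iff)
  have range: "\<theta> k \<in> {0<..<pi}" if "k \<in> {1..n + 1}" for k
    using assms(1)[of k] last(1) that by (cases "k = n + 1") auto
  have "lcm_before \<theta> (n + 1) > 0"
    using assms(1) by (intro lcm_before_pos) auto
  then have nd': "\<not> ideal_gen (\<theta> k) dvd lcm_before \<theta> k" if "k \<in> {1..n + 1}" for k
    using nd[of k] ideal_gen_not_dvd_1[of "\<theta> 1"] range[of 1] d0 that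
    by (cases "k = 1"; cases "k = n + 1") auto
  have "\<exists>j\<in>{1..n + 1}. \<not> ideal_gen (\<theta> j) dvd k" if "k \<ge> 1" for k
    using d0 that by (intro bexI[of _ "n + 1"]) auto
  then show ?thesis using range nd' by unfold_locales auto
qed

lemma admissible0_minimal:
  assumes "m \<in> admissible0"
  shows "minimal_in (\<sqsubseteq>) admissible m"
  using assms unfolding admissible0_def
proof
  assume "m \<in> infinite_construction"
  then obtain \<theta> \<eta> where m: "m = (\<theta> ` {1..}, \<eta>)"
    and a: "\<forall>k\<ge>1. \<theta> k \<in> {0<..<pi} \<and> rational_angle (\<theta> k)"
      "\<forall>k\<ge>2. \<not> ideal_gen (\<theta> k) dvd lcm_before \<theta> k"
    and ext: "\<eta> \<in> extensional (\<theta> ` {1..})"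
    and e: "\<eta> (\<theta> 1) = 1" "\<forall>k\<ge>2. \<eta> (\<theta> k) = lcm_before \<theta> k"
    unfolding infinite_construction_def by blast
  interpret angle_sequence "{1..}" \<theta>
    using a by (intro angle_sequence_infinite) blast+
  \<comment> \<open>The separately prescribed value 1 at the first angle is the empty lcm, so one
    formula covers all indices.\<close>
  have "\<eta> (\<theta> k) = lcm_before \<theta> k" if "k \<in> {1..}" for k
    using e that by (cases "k = 1") auto
  then show ?thesis unfolding m by (intro minimal ext)
next
  assume "m \<in> finite_construction"
  then obtain n \<theta> \<eta> where m: "m = (\<theta> ` {1..n + 1}, \<eta>)"
    and a: "\<forall>k\<in>{1..n}. \<theta> k \<in> {0<..<pi} \<and> rational_angle (\<theta> k)"
      "\<forall>k\<in>{2..n}. \<not> ideal_gen (\<theta> k) dvd lcm_before \<theta> k"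
      "\<theta> (n + 1) \<in> {0<..<pi}" "\<not> rational_angle (\<theta> (n + 1))"
    and ext: "\<eta> \<in> extensional (\<theta> ` {1..n + 1})"
    and e: "\<eta> (\<theta> 1) = 1" "\<forall>k\<in>{2..n + 1}. \<eta> (\<theta> k) = lcm_before \<theta> k"
    unfolding finite_construction_def by blast
  interpret angle_sequence "{1..n + 1}" \<theta>
    using a by (intro angle_sequence_finite) blast+
  have "\<eta> (\<theta> k) = lcm_before \<theta> k" if "k \<in> {1..n + 1}" for k
    using e that by (cases "k = 1") auto
  then show ?thesis unfolding m by (intro minimal ext)
qed

section \<open>Greedy descent from an arbitrary admissible pair\<close>

lemma (in angle_sequence) ex_index_function:
  obtains \<eta> where "\<eta> \<in> extensional (\<theta> ` I)" "\<And>k. k \<in> I \<Longrightarrow> \<eta> (\<theta> k) = lcm_before \<theta> k"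
proof
  \<comment> \<open>Reading the index back off the angle is legitimate because \<theta> is injective
    on \<open>I\<close>.\<close>
  show "restrict (\<lambda>\<phi>. lcm_before \<theta> (inv_into I \<theta> \<phi>)) (\<theta> ` I) \<in> extensional (\<theta> ` I)"
    by simp
qed (simp add: inv_into_f_f[OF inj_on_angle])

text \<open>Admissibility speaks only of positive numbers, and the running lcm becomes 0 once an
  irrational angle has been chosen. The positivity guard leaves the terms after that point
  unconstrained.\<close>

lemma admissible_greedy_sequence:
  assumes "(E, \<eta>) \<in> admissible"
  obtains \<theta> where "\<And>k. \<lbrakk>k \<ge> 1; lcm_before \<theta> k > 0\<rbrakk> \<Longrightarrow>
    \<theta> k \<in> E \<and> \<not> ideal_gen (\<theta> k) dvd lcm_before \<theta> k \<and> \<eta> (\<theta> k) \<le> lcm_before \<theta> k"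
proof -
  have "\<exists>\<phi>. L > 0 \<longrightarrow> \<phi> \<in> E \<and> \<not> ideal_gen \<phi> dvd L \<and> \<eta> \<phi> \<le> L" for L
    using assms unfolding admissible_def sin_mult_eq_0_iff mem_Collect_eq case_prod_conv
    by (metis One_nat_def Suc_leI)
  then obtain c where c: "\<And>L. L > 0 \<Longrightarrow> c L \<in> E \<and> \<not> ideal_gen (c L) dvd L \<and> \<eta> (c L) \<le> L"
    by metis
  \<comment> \<open>The next choice depends on earlier angles only through their lcm, so the
    recursion runs on that number alone. The shift \<open>k - 1\<close> below starts the angles at
    index 1, with \<open>l 0\<close> as the empty lcm.\<close>
  define l where "l = rec_nat 1 (\<lambda>_ L. lcm (ideal_gen (c L)) L)"
  define \<theta> where "\<theta> k = c (l (k - 1))" for k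
  have l: "lcm_before \<theta> (Suc k) = l k" for k
    by (induction k) (simp_all add: lcm_before_Suc l_def \<theta>_def)
  have "lcm_before \<theta> k = l (k - 1)" if "k \<ge> 1" for k
    using l[of "k - 1"] that by simp
  then show thesis using c by (intro that[of \<theta>]) (auto simp: \<theta>_def)
qed

lemma ex_admissible0_below:
  assumes adm: "(E, \<eta>) \<in> admissible"
  shows "\<exists>x\<in>admissible0. x \<sqsubseteq> (E, \<eta>)"
proof -
  obtain \<theta> where \<theta>: "\<And>k. \<lbrakk>k \<ge> 1; lcm_before \<theta> k > 0\<rbrakk> \<Longrightarrow>
      \<theta> k \<in> E \<and> \<not> ideal_gen (\<theta> k) dvd lcm_before \<theta> k \<and> \<eta> (\<theta> k) \<le> lcm_before \<theta> k"
    using admissible_greedy_sequence[OF adm] by metis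
  have E: "E \<subseteq> {0<..<pi}" using adm by (auto simp: admissible_def)
  show ?thesis
  \<comment> \<open>If no irrational angle ever occurs, the whole greedy sequence is an infinite
    construction; otherwise it is cut off at the first irrational angle.\<close>
  proof (cases "\<forall>k\<ge>1. rational_angle (\<theta> k)")
    case True
    then have pos: "lcm_before \<theta> k > 0" for k by (intro lcm_before_pos) auto
    have range: "\<And>k. k \<ge> 1 \<Longrightarrow> \<theta> k \<in> {0<..<pi} \<and> rational_angle (\<theta> k)"
      using True \<theta> pos E by blast
    have nd: "\<And>k. k \<ge> 2 \<Longrightarrow> \<not> ideal_gen (\<theta> k) dvd lcm_before \<theta> k"
      using \<theta> pos by auto
    interpret angle_sequence "{1..}" \<theta>
      using range nd by (rule angle_sequence_infinite)
    obtain \<zeta> where \<zeta>: "\<zeta> \<in> extensional (\<theta> ` {1..})"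
        "\<And>k. k \<in> {1..} \<Longrightarrow> \<zeta> (\<theta> k) = lcm_before \<theta> k"
      using ex_index_function by metis
    have "(\<theta> ` {1..}, \<zeta>) \<in> infinite_construction"
      unfolding infinite_construction_def using range nd \<zeta>
      by (intro CollectI case_prodI exI[of _ \<theta>]) auto
    \<comment> \<open>The greedy bound on \<open>\<eta> (\<theta> k)\<close> by the current lcm is
      exactly the inequality that the order demands.\<close>
    moreover have "(\<theta> ` {1..}, \<zeta>) \<sqsubseteq> (E, \<eta>)"
      using \<theta> pos \<zeta>(2) by (auto simp: angle_le_def)
    ultimately show ?thesis by (auto simp: admissible0_def)
  next
    case False
    define N where "N = (LEAST k. k \<ge> 1 \<and> \<not> rational_angle (\<theta> k))"
    have N: "N \<ge> 1" "\<not> rational_angle (\<theta> N)"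
      using LeastI_ex[of "\<lambda>k. k \<ge> 1 \<and> \<not> rational_angle (\<theta> k)"] False
      unfolding N_def by auto
    define n where "n = N - 1"
    have n: "N = n + 1" using N by (simp add: n_def)
    have rat: "rational_angle (\<theta> k)" if "1 \<le> k" "k < n + 1" for k
      using not_less_Least[of k "\<lambda>k. k \<ge> 1 \<and> \<not> rational_angle (\<theta> k)"] that
      unfolding N_def[symmetric] n by auto
    \<comment> \<open>This reaches index \<open>n + 1\<close> because the lcm there involves only
      the rational angles before it; the greedy choice of the irrational angle is thus still
      constrained.\<close>
    have pos: "lcm_before \<theta> k > 0" if "k \<in> {1..n + 1}" for k
      using that by (intro lcm_before_pos rat) auto
    have inE: "\<theta> k \<in> E" if "k \<in> {1..n + 1}" for k
      using \<theta>[of k] pos[OF that] that by auto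
    have range: "\<And>k. k \<in> {1..n} \<Longrightarrow> \<theta> k \<in> {0<..<pi} \<and> rational_angle (\<theta> k)"
      using rat inE E by fastforce
    have nd: "\<And>k. k \<in> {2..n} \<Longrightarrow> \<not> ideal_gen (\<theta> k) dvd lcm_before \<theta> k"
      using \<theta> pos by auto
    have last: "\<theta> (n + 1) \<in> {0<..<pi}" "\<not> rational_angle (\<theta> (n + 1))"
      using inE[of "n + 1"] E N n by auto
    interpret angle_sequence "{1..n + 1}" \<theta>
      using range nd last by (rule angle_sequence_finite)
    obtain \<zeta> where \<zeta>: "\<zeta> \<in> extensional (\<theta> ` {1..n + 1})"
        "\<And>k. k \<in> {1..n + 1} \<Longrightarrow> \<zeta> (\<theta> k) = lcm_before \<theta> k"
      using ex_index_function by metis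
    have "(\<theta> ` {1..n + 1}, \<zeta>) \<in> finite_construction"
      unfolding finite_construction_def using range nd last \<zeta>
      by (intro CollectI case_prodI exI[of _ n] exI[of _ \<theta>]) auto
    moreover have "(\<theta> ` {1..n + 1}, \<zeta>) \<sqsubseteq> (E, \<eta>)"
      using \<theta> pos \<zeta>(2) inE by (auto simp: angle_le_def)
    ultimately show ?thesis by (auto simp: admissible0_def)
  qed
qed

theorem theorem9p5:
  "{m. minimal_in (\<sqsubseteq>) admissible m} = admissible0"
proof (intro equalityI subsetI)
  fix m assume "m \<in> {m. minimal_in (\<sqsubseteq>) admissible m}"
  then have m: "m \<in> admissible" "\<And>x. \<lbrakk>x \<in> admissible; x \<sqsubseteq> m\<rbrakk> \<Longrightarrow> x = m"
    by (auto simp: minimal_in_def)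
  obtain x where "x \<in> admissible0" "x \<sqsubseteq> m"
    using ex_admissible0_below[of "fst m" "snd m"] m(1) by auto
  \<comment> \<open>Minimality of \<open>m\<close> applies only to admissible pairs; once
    \<open>x\<close> is known to be one, it must equal \<open>m\<close>.\<close>
  moreover have "x \<in> admissible"
    using admissible0_minimal[OF \<open>x \<in> admissible0\<close>] by (simp add: minimal_in_def)
  ultimately show "m \<in> admissible0" using m(2) by metis
qed (simp add: admissible0_minimal)

end
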